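(* Let $n \geq 3$ and $1 \leq k \leq n-1$ be integers. If $G$ is a simple graph of order $n$ that has the fan graph $F_n$ as a spanning subgraph, then the $k$-token graph $G^{(k)}$ is Hamiltonian. In particular, the Johnson graph $J(n,k)$ is Hamiltonian, and, for $n \geq 4$, the $k$-token graph $W_n^{(k)}$ of the wheel graph $W_n$ is Hamiltonian.
   Context: All graphs are simple and finite. For a simple graph $G$ of order $n$ and an integer $k$ with $1 \leq k \leq n-1$, the $k$-token graph $G^{(k)}$ of $G$ is the graph whose vertices are the $k$-element subsets of $V(G)$, where two such subsets $A, B$ are adjacent if and only if their symmetric difference $A \triangle B$ is an edge of $G$ (that is, $A \triangle B = \{a,b\}$ with $a$ and $b$ adjacent in $G$). The fan graph $F_n$ is the join of $K_1$ and $P_{n-1}$, where $P_{n-1}$ is the path on $n-1$ vertices. The wheel graph $W_n$ is the join of $K_1$ and the cycle $C_{n-1}$ on $n-1$ vertices. The Johnson graph $J(n,k)$ is (isomorphic to) the $k$-token graph $K_n^{(k)}$ of the complete graph $K_n$: its vertices are the $k$-subsets of an $n$-set, two being adjacent when they intersect in exactly $k-1$ elements. A spanning subgraph of $G$ is a subgraph $H$ with $V(H)=V(G)$; $G$ has $F_n$ as a spanning subgraph if some spanning subgraph of $G$ is isomorphic to $F_n$. A graph is Hamiltonian if it contains a Hamiltonian cycle, i.e. a cycle passing through every vertex exactly once. *)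

theory Defs
  imports "Graph_Theory.Graph_Theory"
begin

text \<open>
  Finite simple graphs are the locale \<^locale>\<open>pair_graph\<close>: an edge between \<open>a\<close> and \<open>b\<close> is
  represented by the two arcs \<open>(a, b)\<close> and \<open>(b, a)\<close>. The coercion \<^const>\<open>with_proj\<close> to general
  digraphs is inserted automatically.
\<close>

definition complete_graph :: "nat \<Rightarrow> nat pair_pre_digraph" where
  "complete_graph m = \<lparr> pverts = {0..<m}, parcs = {(i, j). i < m \<and> j < m \<and> i \<noteq> j} \<rparr>"

definition path_graph :: "nat \<Rightarrow> nat pair_pre_digraph" where
  "path_graph m =
    \<lparr> pverts = {0..<m}, parcs = {(i, j). i < m \<and> j < m \<and> (j = Suc i \<or> i = Suc j)} \<rparr>"

text \<open>The condition \<open>i \<noteq> j\<close> only excludes the loop that would arise for \<open>m = 1\<close>.\<close>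

definition cycle_graph :: "nat \<Rightarrow> nat pair_pre_digraph" where
  "cycle_graph m =
    \<lparr> pverts = {0..<m},
      parcs = {(i, j). i < m \<and> j < m \<and> i \<noteq> j \<and> (j = Suc i mod m \<or> i = Suc j mod m)} \<rparr>"

definition graph_join ::
  "'a pair_pre_digraph \<Rightarrow> 'b pair_pre_digraph \<Rightarrow> ('a + 'b) pair_pre_digraph" where
  "graph_join G H =
    \<lparr> pverts = pverts G <+> pverts H,
      parcs = {(Inl a, Inl b) | a b. (a, b) \<in> parcs G}
            \<union> {(Inr a, Inr b) | a b. (a, b) \<in> parcs H}
            \<union> {(Inl a, Inr b) | a b. a \<in> pverts G \<and> b \<in> pverts H}
            \<union> {(Inr b, Inl a) | a b. a \<in> pverts G \<and> b \<in> pverts H} \<rparr>"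

definition fan_graph :: "nat \<Rightarrow> (nat + nat) pair_pre_digraph" where
  "fan_graph n = graph_join (complete_graph 1) (path_graph (n - 1))"

definition wheel_graph :: "nat \<Rightarrow> (nat + nat) pair_pre_digraph" where
  "wheel_graph n = graph_join (complete_graph 1) (cycle_graph (n - 1))"

definition token_graph :: "'a pair_pre_digraph \<Rightarrow> nat \<Rightarrow> 'a set pair_pre_digraph" where
  "token_graph G k =
    \<lparr> pverts = {A. A \<subseteq> pverts G \<and> card A = k},
      parcs = {(A, B). A \<subseteq> pverts G \<and> card A = k \<and> B \<subseteq> pverts G \<and> card B = k
                 \<and> (\<exists>a b. (a, b) \<in> parcs G \<and> sym_diff A B = {a, b})} \<rparr>"

definition johnson_graph :: "nat \<Rightarrow> nat \<Rightarrow> nat set pair_pre_digraph" where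
  "johnson_graph n k =
    \<lparr> pverts = {A. A \<subseteq> {0..<n} \<and> card A = k},
      parcs = {(A, B). A \<subseteq> {0..<n} \<and> card A = k \<and> B \<subseteq> {0..<n} \<and> card B = k
                 \<and> card (A \<inter> B) + 1 = k} \<rparr>"

definition has_spanning_subgraph_iso :: "'a pair_pre_digraph \<Rightarrow> 'b pair_pre_digraph \<Rightarrow> bool" where
  "has_spanning_subgraph_iso G F \<longleftrightarrow>
    (\<exists>H :: 'a pair_pre_digraph. pair_graph H \<and> spanning H G \<and> digraph_iso H F)"

text \<open>
  \<^const>\<open>pre_digraph.cycle\<close> admits the closed walk \<open>a, b, a\<close> along a single edge;
  the length condition excludes it.
\<close>

definition hamiltonian_cycle :: "('a, 'b) pre_digraph \<Rightarrow> 'a \<Rightarrow> 'b list \<Rightarrow> bool" where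
  "hamiltonian_cycle G u p \<longleftrightarrow>
    pre_digraph.awalk G u p u \<and> pre_digraph.cycle G p \<and> 3 \<le> length p
    \<and> set (pre_digraph.awalk_verts G u p) = verts G"

definition hamiltonian :: "('a, 'b) pre_digraph \<Rightarrow> bool" where
  "hamiltonian G \<longleftrightarrow> (\<exists>u p. hamiltonian_cycle G u p)"

lemma complete_graph_pair_graph: "pair_graph (complete_graph m)"
  by unfold_locales
    (auto simp: complete_graph_def symmetric_def arcs_ends_def arc_to_ends_def intro!: symI
      intro: finite_subset[of _ "{0..<m} \<times> {0..<m}"])

lemma path_graph_pair_graph: "pair_graph (path_graph m)"
  by unfold_locales
    (auto simp: path_graph_def symmetric_def arcs_ends_def arc_to_ends_def intro!: symI
      intro: finite_subset[of _ "{0..<m} \<times> {0..<m}"])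

lemma cycle_graph_pair_graph: "pair_graph (cycle_graph m)"
  by unfold_locales
    (auto simp: cycle_graph_def symmetric_def arcs_ends_def arc_to_ends_def intro!: symI
      intro: finite_subset[of _ "{0..<m} \<times> {0..<m}"])

lemma complete_graph_complete_digraph: "complete_digraph m (complete_graph m)"
proof -
  interpret pair_graph "complete_graph m" by (rule complete_graph_pair_graph)
  show ?thesis
    unfolding complete_digraph_def
    using graph_axioms by (auto simp: complete_graph_def arcs_ends_def arc_to_ends_def with_proj_def)
qed

lemma pair_graph_of_relI:
  assumes fin: "finite (pverts G)" and sub: "parcs G \<subseteq> pverts G \<times> pverts G"
    and sym: "sym (parcs G)" and loopfree: "\<And>e. e \<in> parcs G \<Longrightarrow> fst e \<noteq> snd e"
  shows "pair_graph G"
proof unfold_locales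
  show "finite (parcs G)"
    using finite_subset[OF sub] fin by blast
  show "symmetric (with_proj G)"
    using sym by (simp add: symmetric_def)
  show "fst e \<in> pverts G" "snd e \<in> pverts G" if "e \<in> parcs G" for e
    using subsetD[OF sub that] by (simp_all add: mem_Times_iff)
qed (fact fin, fact loopfree)

lemma graph_join_pair_graph:
  assumes "pair_graph G" "pair_graph H"
  shows "pair_graph (graph_join G H)"
proof -
  interpret G: pair_graph G by fact
  interpret H: pair_graph H by fact
  have sub: "parcs (graph_join G H) \<subseteq> pverts (graph_join G H) \<times> pverts (graph_join G H)"
    by (auto simp: graph_join_def dest: G.wellformed' H.wellformed')
  have fin: "finite (pverts (graph_join G H))"
    by (simp add: graph_join_def)
  have "sym (parcs (graph_join G H))"
    using G.arcs_symmetric H.arcs_symmetric by (auto simp: graph_join_def intro!: symI)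
  moreover have "fst e \<noteq> snd e" if "e \<in> parcs (graph_join G H)" for e
    using that G.no_loops H.no_loops by (auto simp: graph_join_def)
  ultimately show ?thesis
    using fin by (intro pair_graph_of_relI[OF _ sub])
qed

lemma token_graph_pair_graph:
  assumes "pair_graph G"
  shows "pair_graph (token_graph G k)"
proof -
  interpret G: pair_graph G by fact
  have sub: "parcs (token_graph G k) \<subseteq> pverts (token_graph G k) \<times> pverts (token_graph G k)"
    by (auto simp: token_graph_def)
  have fin: "finite (pverts (token_graph G k))"
    by (rule finite_subset[of _ "Pow (pverts G)"]) (auto simp: token_graph_def)
  have "sym (parcs (token_graph G k))"
  proof (rule symI)
    fix A B
    assume "(A, B) \<in> parcs (token_graph G k)"
    moreover have "sym_diff B A = sym_diff A B"
      by blast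
    ultimately show "(B, A) \<in> parcs (token_graph G k)"
      by (simp only: token_graph_def pair_pre_digraph.simps mem_Collect_eq prod.case)
  qed
  moreover have "fst e \<noteq> snd e" if e: "e \<in> parcs (token_graph G k)" for e
  proof
    assume eq: "fst e = snd e"
    obtain a b where "sym_diff (fst e) (snd e) = {a, b}"
      using e unfolding token_graph_def pair_pre_digraph.simps mem_Collect_eq case_prod_beta
      by blast
    then show False
      unfolding eq Diff_cancel Un_empty_left by (metis insert_not_empty)
  qed
  ultimately show ?thesis
    using fin by (intro pair_graph_of_relI[OF _ sub])
qed

lemma johnson_graph_eq_token_graph:
  "johnson_graph n k = token_graph (complete_graph n) k"
proof -
  have key: "card (A \<inter> B) + 1 = k \<longleftrightarrow> (\<exists>a b. a < n \<and> b < n \<and> a \<noteq> b \<and> sym_diff A B = {a, b})"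
    if A: "A \<subseteq> {0..<n}" "card A = k" and B: "B \<subseteq> {0..<n}" "card B = k" for A B
  proof -
    have fA: "finite A" and fB: "finite B"
      using A B finite_subset by blast+
    have cA: "card (A - B) + card (A \<inter> B) = k"
      using card_Int_Diff[OF fA, of B] A by simp
    have cB: "card (B - A) + card (A \<inter> B) = k"
      using card_Int_Diff[OF fB, of A] B by (simp add: Int_commute)
    have cS: "card (sym_diff A B) = card (A - B) + card (B - A)"
      using fA fB by (intro card_Un_disjoint) auto
    show ?thesis
    proof
      assume "card (A \<inter> B) + 1 = k"
      then have "card (sym_diff A B) = 2"
        using cA cB cS by linarith
      then obtain a b where "sym_diff A B = {a, b}" "a \<noteq> b"
        by (auto simp: card_2_iff)
      moreover have "sym_diff A B \<subseteq> {0..<n}"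
        using A B by blast
      ultimately have "a < n \<and> b < n \<and> a \<noteq> b \<and> sym_diff A B = {a, b}"
        by auto
      then show "\<exists>a b. a < n \<and> b < n \<and> a \<noteq> b \<and> sym_diff A B = {a, b}"
        by blast
    next
      assume "\<exists>a b. a < n \<and> b < n \<and> a \<noteq> b \<and> sym_diff A B = {a, b}"
      then have "card (sym_diff A B) = 2"
        by (metis card_2_iff)
      then show "card (A \<inter> B) + 1 = k"
        using cA cB cS by linarith
    qed
  qed
  have "(A, B) \<in> parcs (johnson_graph n k)
      \<longleftrightarrow> (A, B) \<in> parcs (token_graph (complete_graph n) k)" for A B
    unfolding johnson_graph_def token_graph_def complete_graph_def pair_pre_digraph.simps
      mem_Collect_eq prod.case conj_assoc
    by (intro conj_cong refl) (rule key)
  then have "parcs (johnson_graph n k) = parcs (token_graph (complete_graph n) k)"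
    by auto
  then show ?thesis
    by (intro pair_pre_digraph.equality)
      (simp_all only: johnson_graph_def token_graph_def complete_graph_def pair_pre_digraph.simps)
qed

end

theory Submission
  imports Defs
begin

text \<open>
  Label the fan so that its hub is \<open>0\<close> and its path is \<open>1, \<dots>, m\<close> with \<open>m = n - 1\<close>. A Hamiltonian cycle
  of the \<open>k\<close>-token graph of this labelled fan is transported to the token graph of every graph that
  contains the fan as a spanning subgraph, in particular to those of the complete graph (the Johnson
  graph) and of the wheel. So the labelled fan is all that matters.

  For it, the \<open>k\<close>-subsets of \<open>{0..m + 1}\<close> split into those that avoid \<open>m + 1\<close>, which form the
  \<open>k\<close>-token graph of the fan on \<open>{0..m}\<close>, and those that contain it, which form a copy of the
  \<open>(k - 1)\<close>-token graph of the same fan. By induction both parts have Hamiltonian cycles. Two disjoint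
  cycles can be fused along a 4-cycle that alternates between an edge of the first, a crossing edge, an
  edge of the second and a crossing edge. Sliding a token from \<open>m\<close> to \<open>m + 1\<close> supplies crossing
  edges: if \<open>{P, Q}\<close> is an edge of the second cycle, seen in the \<open>(k - 1)\<close>-token graph, and
  \<open>{P \<union> {m}, Q \<union> {m}}\<close> is an edge of the first, then these sets together with
  \<open>P \<union> {m + 1}\<close> and \<open>Q \<union> {m + 1}\<close> form such a 4-cycle.

  After the first fusion, an edge of the first cycle whose ends both contain \<open>m\<close> comes from the
  second half that the previous fusion put there, and that fusion destroyed the edge it used. Hence two
  different edges \<open>exchange_edge1 k\<close> and \<open>exchange_edge2 k\<close>, chosen independently of \<open>m\<close>, are kept in
  the cycle on the \<open>k\<close>-subsets for every \<open>m\<close>. Each fusion uses one of the two edges of level \<open>k - 1\<close> and leaves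
  the lifted copy of the other for the next fusion; this is lemma \<open>exchange_step\<close>. For \<open>k \<ge> 2\<close>,
  the two edges of level \<open>k\<close> itself survive because both contain the vertex \<open>{0..<k}\<close>, whereas all ends of the edge
  removed from the first cycle contain \<open>m \<ge> k\<close>. The induction on \<open>m\<close> starts at \<open>m = k\<close>, where a
  \<open>k\<close>-subset is given by the one position that is left free and moving this gap around \<open>0, \<dots>, k\<close>
  is a Hamiltonian cycle; the induction on \<open>k\<close> starts with the cycle \<open>0, \<dots>, m\<close> of the fan.
\<close>

section \<open>Cyclic lists and the fusion of two cycles\<close>

fun path_edges :: "'a list \<Rightarrow> 'a set set" where
  "path_edges (x # y # zs) = insert {x, y} (path_edges (y # zs))"
| "path_edges _ = {}"

definition ring_edges :: "'a list \<Rightarrow> 'a set set" where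
  "ring_edges xs = insert {last xs, hd xs} (path_edges xs)"

text \<open>
  A Hamiltonian cycle is a duplicate-free cyclic list. Adjacency is given by a set \<open>E\<close> of unordered
  pairs, so that the edges of a cycle are a plain set that is invariant under rotation and reversal.
\<close>

definition ham_ring :: "'a set \<Rightarrow> 'a set set \<Rightarrow> 'a list \<Rightarrow> bool" where
  "ham_ring V E xs \<longleftrightarrow> distinct xs \<and> set xs = V \<and> ring_edges xs \<subseteq> E \<and> 3 \<le> length xs"

lemma path_edges_append:
  assumes "xs \<noteq> []" "ys \<noteq> []"
  shows "path_edges (xs @ ys) = insert {last xs, hd ys} (path_edges xs \<union> path_edges ys)"
  using assms
proof (induction xs rule: path_edges.induct)
  case ("2_2" x)
  then show ?case by (cases ys) auto
qed auto

lemma path_edges_rev: "path_edges (rev xs) = path_edges xs"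
proof (induction xs rule: path_edges.induct)
  case (1 x y zs)
  then have "path_edges (rev (x # y # zs)) = insert {y, x} (path_edges (y # zs))"
    using path_edges_append[of "rev (y # zs)" "[x]"] by (simp add: last_rev)
  then show ?case by (simp add: insert_commute)
qed auto

lemma path_edges_map: "path_edges (map f xs) = image f ` path_edges xs"
  by (induction xs rule: path_edges.induct) auto

lemma ring_edges_map: "xs \<noteq> [] \<Longrightarrow> ring_edges (map f xs) = image f ` ring_edges xs"
  by (simp add: ring_edges_def path_edges_map last_map hd_map)

lemma ring_edges_rev: "xs \<noteq> [] \<Longrightarrow> ring_edges (rev xs) = ring_edges xs"
  by (simp add: ring_edges_def path_edges_rev last_rev hd_rev insert_commute)

lemma ring_edges_rotate:
  "xs \<noteq> [] \<Longrightarrow> ys \<noteq> [] \<Longrightarrow> ring_edges (ys @ xs) = ring_edges (xs @ ys)"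
  by (auto simp: ring_edges_def path_edges_append)

lemma path_edges_split:
  "e \<in> path_edges xs \<Longrightarrow> \<exists>us vs. xs = us @ vs \<and> us \<noteq> [] \<and> vs \<noteq> [] \<and> e = {last us, hd vs}"
proof (induction xs rule: path_edges.induct)
  case (1 x y zs)
  show ?case
  proof (cases "e = {x, y}")
    case True
    then show ?thesis by (intro exI[of _ "[x]"] exI[of _ "y # zs"]) simp
  next
    case False
    then obtain us vs where "y # zs = us @ vs" "us \<noteq> []" "vs \<noteq> []" "e = {last us, hd vs}"
      using 1 by auto
    then show ?thesis by (intro exI[of _ "x # us"] exI[of _ vs]) simp
  qed
qed auto

lemma ham_ring_rev: "ham_ring V E xs \<Longrightarrow> ham_ring V E (rev xs)"
  using ring_edges_rev[of xs] by (force simp: ham_ring_def)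

text \<open>
  Any edge of a cycle may be taken as the closing one, after a rotation and possibly a reversal;
  removing it leaves the Hamiltonian path on which the fusion of two cycles operates.
\<close>

lemma ham_ring_open_at:
  assumes ring: "ham_ring V E xs" and e: "{a, b} \<in> ring_edges xs"
  shows "\<exists>ys. ham_ring V E ys \<and> ring_edges ys = ring_edges xs \<and> hd ys = a \<and> last ys = b"
proof -
  have ne: "xs \<noteq> []" using ring by (auto simp: ham_ring_def)
  obtain ys where ys: "ham_ring V E ys" "ring_edges ys = ring_edges xs" "{a, b} = {last ys, hd ys}"
  proof (cases "{a, b} = {last xs, hd xs}")
    case True
    then show ?thesis using that ring by blast
  next
    case False
    then have "{a, b} \<in> path_edges xs" using e by (simp add: ring_edges_def)
    then obtain us vs where uv: "xs = us @ vs" "us \<noteq> []" "vs \<noteq> []" "{a, b} = {last us, hd vs}"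
      using path_edges_split by blast
    have "ham_ring V E (vs @ us)"
      using ring uv ring_edges_rotate[of us vs] by (auto simp: ham_ring_def)
    then show ?thesis
      using that[of "vs @ us"] uv ring_edges_rotate[of us vs] by simp
  qed
  have "ys \<noteq> []" using ys by (auto simp: ham_ring_def)
  show ?thesis
  proof (cases "hd ys = a")
    case True
    then show ?thesis using ys by (auto simp: doubleton_eq_iff)
  next
    case False
    then have "last ys = a" "hd ys = b" using ys(3) by (auto simp: doubleton_eq_iff)
    then show ?thesis
      using ys ham_ring_rev[OF ys(1)] ring_edges_rev[OF \<open>ys \<noteq> []\<close>] \<open>ys \<noteq> []\<close>
      by (intro exI[of _ "rev ys"]) (simp add: hd_rev last_rev)
  qed
qed

text \<open>
  The edges \<open>{a, b}\<close> and \<open>{c, d}\<close> are exchanged for \<open>{a, c}\<close> and \<open>{b, d}\<close>: what remains of the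
  two cycles is a path from \<open>a\<close> to \<open>b\<close> and a path from \<open>d\<close> to \<open>c\<close>, and their concatenation closes up.
  That all other edges are retained is what makes the operation repeatable.
\<close>

lemma ham_ring_merge:
  assumes xs: "ham_ring V E xs" and ys: "ham_ring W E ys" and disj: "V \<inter> W = {}"
    and ab: "{a, b} \<in> ring_edges xs" and cd: "{c, d} \<in> ring_edges ys"
    and ac: "{a, c} \<in> E" and bd: "{b, d} \<in> E"
  shows "\<exists>zs. ham_ring (V \<union> W) E zs
    \<and> (ring_edges xs - {{a, b}}) \<union> (ring_edges ys - {{c, d}}) \<subseteq> ring_edges zs"
proof -
  obtain us where us: "ham_ring V E us" "ring_edges us = ring_edges xs" "hd us = a" "last us = b"
    using ham_ring_open_at[OF xs ab] by blast
  have "{d, c} \<in> ring_edges ys" using cd by (simp add: insert_commute)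
  then obtain vs where vs: "ham_ring W E vs" "ring_edges vs = ring_edges ys" "hd vs = d" "last vs = c"
    using ham_ring_open_at[OF ys] by blast
  have ne: "us \<noteq> []" "vs \<noteq> []" using us vs by (auto simp: ham_ring_def)
  have edges: "ring_edges (us @ vs) = {{a, c}, {b, d}} \<union> path_edges us \<union> path_edges vs"
    using ne us vs by (auto simp: ring_edges_def path_edges_append)
  have "path_edges us \<subseteq> E" "path_edges vs \<subseteq> E"
    using us(1) vs(1) by (auto simp: ham_ring_def ring_edges_def)
  then have "ham_ring (V \<union> W) E (us @ vs)"
    using us(1) vs(1) disj ac bd unfolding ham_ring_def edges by auto
  moreover have "ring_edges xs - {{a, b}} \<subseteq> path_edges us" "ring_edges ys - {{c, d}} \<subseteq> path_edges vs"
    using us vs unfolding ring_edges_def by (metis Diff_subset_conv insert_commute insert_is_Un subset_refl)+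
  ultimately show ?thesis unfolding edges[symmetric] using edges by blast
qed

section \<open>Tokens on the labelled fan\<close>

definition fan_adj :: "nat \<Rightarrow> nat \<Rightarrow> bool" where
  "fan_adj a b \<longleftrightarrow> a \<noteq> b \<and> (a = 0 \<or> b = 0 \<or> a = Suc b \<or> b = Suc a)"

definition token_sets :: "nat \<Rightarrow> nat \<Rightarrow> nat set set" where
  "token_sets m k = {A. A \<subseteq> {0..m} \<and> card A = k}"

definition fan_moves :: "nat set set set" where
  "fan_moves = {{A, B} | A B. \<exists>a b. fan_adj a b \<and> sym_diff A B = {a, b}}"

lemma fan_movesI: "fan_adj a b \<Longrightarrow> sym_diff A B = {a, b} \<Longrightarrow> {A, B} \<in> fan_moves"
  unfolding fan_moves_def by blast

text \<open>
  The two edges that the Hamiltonian cycle on \<open>k\<close>-subsets keeps available for later fusions, whatever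
  the length of the path. For \<open>k \<ge> 2\<close> they are consecutive edges of the cycle on the \<open>k\<close>-subsets of
  \<open>{0..k}\<close>, meeting in \<open>{0..<k}\<close>: the gap moves from \<open>k\<close> to \<open>0\<close> in the first and from \<open>k\<close> to \<open>k - 1\<close> in
  the second. For \<open>k = 1\<close> these two moves coincide, since \<open>{0..1}\<close> has only two 1-subsets, so the first
  one is replaced by the next edge of the path.
\<close>

definition exchange_edge1 :: "nat \<Rightarrow> nat set set" where
  "exchange_edge1 k = (if k = 1 then {{1}, {2}} else {{0..<k}, {1..k}})"

definition exchange_edge2 :: "nat \<Rightarrow> nat set set" where
  "exchange_edge2 k = {{0..<k}, {0..k} - {k - 1}}"

lemma exchange_edges_distinct:
  assumes "1 \<le> k"
  shows "exchange_edge1 k \<noteq> exchange_edge2 k"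
proof -
  have "{1..k} \<in> exchange_edge1 k"
    by (simp add: exchange_edge1_def)
  moreover have "{1..k} \<notin> exchange_edge2 k" if "k \<noteq> 1"
  proof -
    have "0 \<in> A" if "A \<in> exchange_edge2 k" for A
      using that assms \<open>k \<noteq> 1\<close> by (auto simp: exchange_edge2_def)
    then show ?thesis by force
  qed
  moreover have "{2} \<in> exchange_edge1 1"
    by (simp add: exchange_edge1_def)
  moreover have "{2} \<notin> exchange_edge2 1"
  proof -
    have "2 \<notin> A" if "A \<in> exchange_edge2 1" for A
      using that unfolding exchange_edge2_def by fastforce
    then show ?thesis by blast
  qed
  ultimately show ?thesis by metis
qed

lemma path_edges_map_upt: "path_edges (map f [0..<Suc n]) = {{f i, f (Suc i)} | i. i < n}"
proof (induction n)
  case (Suc n)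
  have "path_edges (map f [0..<Suc n] @ [f (Suc n)])
      = insert {f n, f (Suc n)} (path_edges (map f [0..<Suc n]))"
    by (subst path_edges_append) (auto simp: last_map)
  then show ?case using Suc by (auto simp: less_Suc_eq)
qed auto

lemma ring_edges_map_upt:
  "ring_edges (map f [0..<Suc n]) = insert {f n, f 0} {{f i, f (Suc i)} | i. i < n}"
  unfolding ring_edges_def path_edges_map_upt by (simp add: last_map hd_map del: upt_Suc)

lemma ring_edges_map_upt_consecutive: "i < n \<Longrightarrow> {f i, f (Suc i)} \<in> ring_edges (map f [0..<Suc n])"
  unfolding ring_edges_map_upt by blast

lemma one_token_ring:
  assumes "2 \<le> m"
  shows "\<exists>xs. ham_ring (token_sets m 1) fan_moves xs
    \<and> exchange_edge1 1 \<in> ring_edges xs \<and> exchange_edge2 1 \<in> ring_edges xs"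
proof (intro exI conjI)
  let ?xs = "map (\<lambda>i. {i}) [0..<Suc m]"
  have "{{i}, {j}} \<in> fan_moves" if "fan_adj i j" for i j
    using that by (intro fan_movesI[OF that]) (auto simp: fan_adj_def)
  then have "ring_edges ?xs \<subseteq> fan_moves"
    unfolding ring_edges_map_upt using assms by (auto simp: fan_adj_def)
  then show "ham_ring (token_sets m 1) fan_moves ?xs"
    using assms unfolding ham_ring_def
    by (auto simp: token_sets_def card_1_singleton_iff distinct_map simp del: upt_Suc)
  show "exchange_edge1 1 \<in> ring_edges ?xs" "exchange_edge2 1 \<in> ring_edges ?xs"
    using ring_edges_map_upt_consecutive[of 1 m "\<lambda>i. {i}"] ring_edges_map_upt_consecutive[of 0 m "\<lambda>i. {i}"]
      assms by (simp_all add: exchange_edge1_def exchange_edge2_def numeral_2_eq_2 insert_Diff_if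
        atLeast0_atMost_Suc del: upt_Suc)
qed

text \<open>
  The gap runs through the cycle \<open>0, 1, \<dots>, k\<close> of the fan, which consists of the path and of the edges
  from the hub to its two ends. The third membership feeds the first fusion: if the gap moves between \<open>k - 1\<close> and \<open>k - 2\<close>, the
  position \<open>k\<close> is occupied, and without it the move is the second exchange edge of level \<open>k - 1\<close>.
\<close>

lemma one_gap_ring:
  assumes "2 \<le> k"
  shows "\<exists>xs. ham_ring (token_sets k k) fan_moves xs
    \<and> exchange_edge1 k \<in> ring_edges xs \<and> exchange_edge2 k \<in> ring_edges xs
    \<and> insert k ` exchange_edge2 (k - 1) \<in> ring_edges xs"
proof (intro exI conjI)
  let ?f = "\<lambda>c. {0..k} - {c}"
  let ?xs = "map ?f [0..<Suc k]"
  have inj: "inj_on ?f {0..k}" by (rule inj_onI) blast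
  have "{?f i, ?f j} \<in> fan_moves" if "fan_adj i j" "i \<le> k" "j \<le> k" for i j
  proof -
    have "sym_diff (?f i) (?f j) = {i, j}" using that by (auto simp: fan_adj_def)
    then show ?thesis using that by (intro fan_movesI)
  qed
  then have "ring_edges ?xs \<subseteq> fan_moves"
    unfolding ring_edges_map_upt using assms by (auto simp: fan_adj_def)
  moreover have "set ?xs = token_sets k k"
  proof -
    have "A \<in> ?f ` {0..k}" if A: "A \<subseteq> {0..k}" "card A = k" for A
    proof -
      have "card ({0..k} - A) = 1" using A by (simp add: card_Diff_subset finite_subset)
      then obtain c where "{0..k} - A = {c}" by (auto simp: card_1_singleton_iff)
      then have "A = ?f c" "c \<in> {0..k}" using A by auto
      then show ?thesis by blast
    qed
    moreover have "?f c \<in> token_sets k k" if "c \<le> k" for c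
      using that by (auto simp: token_sets_def)
    moreover have "set ?xs = ?f ` {0..k}" by (simp add: atLeastLessThanSuc_atLeastAtMost del: upt_Suc)
    ultimately show ?thesis unfolding token_sets_def by fastforce
  qed
  moreover have "distinct ?xs" using inj by (simp add: distinct_map atLeastLessThanSuc_atLeastAtMost del: upt_Suc)
  ultimately show "ham_ring (token_sets k k) fan_moves ?xs"
    using assms unfolding ham_ring_def by simp
  have f: "?f k = {0..<k}" "?f 0 = {1..k}" by auto
  then show "exchange_edge1 k \<in> ring_edges ?xs"
    unfolding ring_edges_map_upt exchange_edge1_def using assms by simp
  have "exchange_edge2 k = {?f (k - 1), ?f (Suc (k - 1))}"
    using f assms by (simp add: exchange_edge2_def insert_commute)
  then show "exchange_edge2 k \<in> ring_edges ?xs"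
    using ring_edges_map_upt_consecutive[of "k - 1" k ?f] assms by (simp del: upt_Suc)
  have "insert k {0..<k - 1} = ?f (Suc (k - 2))" "insert k ({0..k - 1} - {k - 1 - 1}) = ?f (k - 2)"
    using assms by auto
  then have "insert k ` exchange_edge2 (k - 1) = {?f (k - 2), ?f (Suc (k - 2))}"
    by (simp only: exchange_edge2_def image_insert image_empty insert_commute)
  then show "insert k ` exchange_edge2 (k - 1) \<in> ring_edges ?xs"
    using ring_edges_map_upt_consecutive[of "k - 2" k ?f] assms by (simp del: upt_Suc)
qed

text \<open>
  The recursion of Pascal's triangle, by whether the last path vertex carries a token.
\<close>

lemma token_sets_Suc:
  "token_sets (Suc m) (Suc k) = token_sets m (Suc k) \<union> insert (Suc m) ` token_sets m k"
proof (intro equalityI subsetI)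
  fix A assume A: "A \<in> token_sets (Suc m) (Suc k)"
  show "A \<in> token_sets m (Suc k) \<union> insert (Suc m) ` token_sets m k"
  proof (cases "Suc m \<in> A")
    case True
    then have "A = insert (Suc m) (A - {Suc m})" by auto
    moreover have "A - {Suc m} \<in> token_sets m k"
      using A True by (auto simp: token_sets_def atLeast0_atMost_Suc)
    ultimately show ?thesis by blast
  next
    case False
    then show ?thesis using A by (auto simp: token_sets_def atLeast0_atMost_Suc)
  qed
next
  fix A assume "A \<in> token_sets m (Suc k) \<union> insert (Suc m) ` token_sets m k"
  then show "A \<in> token_sets (Suc m) (Suc k)"
  proof
    assume "A \<in> insert (Suc m) ` token_sets m k"
    then obtain B where B: "A = insert (Suc m) B" "B \<subseteq> {0..m}" "card B = k"
      by (auto simp: token_sets_def)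
    then have "finite B" "Suc m \<notin> B" using finite_subset by auto
    then show ?thesis using B by (auto simp: token_sets_def)
  qed (auto simp: token_sets_def)
qed

lemma insert_inj_on: "inj_on (insert x) {A. x \<notin> A}"
  by (rule inj_onI) (simp add: insert_ident)

lemma fan_moves_insert:
  assumes "e \<in> fan_moves" "\<And>A. A \<in> e \<Longrightarrow> x \<notin> A"
  shows "insert x ` e \<in> fan_moves"
proof -
  obtain A B a b where *: "e = {A, B}" "fan_adj a b" "sym_diff A B = {a, b}"
    using assms(1) by (auto simp: fan_moves_def)
  then have "sym_diff (insert x A) (insert x B) = {a, b}"
    using assms(2)[of A] assms(2)[of B] by blast
  then show ?thesis unfolding *(1) image_insert image_empty by (rule fan_movesI[OF *(2)])
qed

lemma path_edges_subset: "e \<in> path_edges xs \<Longrightarrow> e \<subseteq> set xs"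
  by (induction xs rule: path_edges.induct) auto

lemma ring_edges_subset: "xs \<noteq> [] \<Longrightarrow> e \<in> ring_edges xs \<Longrightarrow> e \<subseteq> set xs"
  using path_edges_subset[of e xs] by (auto simp: ring_edges_def)

lemma ham_ring_insert:
  assumes "ham_ring (token_sets m k) fan_moves xs"
  shows "ham_ring (insert (Suc m) ` token_sets m k) fan_moves (map (insert (Suc m)) xs)"
proof -
  have ne: "xs \<noteq> []" and set: "set xs = token_sets m k" using assms by (auto simp: ham_ring_def)
  have notin: "Suc m \<notin> A" if "A \<in> token_sets m k" for A using that by (auto simp: token_sets_def)
  have "inj_on (insert (Suc m)) (set xs)"
    using insert_inj_on by (rule inj_on_subset) (auto simp: set notin)
  moreover have "insert (Suc m) ` e \<in> fan_moves" if "e \<in> ring_edges xs" for e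
    using assms that ring_edges_subset[OF ne that] notin set
    by (intro fan_moves_insert) (auto simp: ham_ring_def)
  ultimately show ?thesis
    using assms unfolding ham_ring_def by (auto simp: distinct_map ring_edges_map ne)
qed

text \<open>
  One fusion. The edge \<open>{P, Q}\<close> of level \<open>k\<close> is used up, and any other edge \<open>e'\<close> of the level-\<open>k\<close> cycle
  survives in lifted form, ready to be used when the path is extended once more.
\<close>

lemma exchange_step:
  assumes "1 \<le> k" "Suc k \<le> m"
    and xs: "ham_ring (token_sets m (Suc k)) fan_moves xs"
    and keep: "exchange_edge1 (Suc k) \<in> ring_edges xs" "exchange_edge2 (Suc k) \<in> ring_edges xs"
    and ys: "ham_ring (token_sets m k) fan_moves ys"
    and e: "{P, Q} \<in> ring_edges ys" "insert m ` {P, Q} \<in> ring_edges xs"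
    and e': "e' \<in> ring_edges ys" "e' \<noteq> {P, Q}"
  shows "\<exists>zs. ham_ring (token_sets (Suc m) (Suc k)) fan_moves zs
    \<and> exchange_edge1 (Suc k) \<in> ring_edges zs \<and> exchange_edge2 (Suc k) \<in> ring_edges zs
    \<and> insert (Suc m) ` e' \<in> ring_edges zs"
proof -
  let ?ins = "insert (Suc m)"
  have ne: "xs \<noteq> []" "ys \<noteq> []" and set: "set xs = token_sets m (Suc k)" "set ys = token_sets m k"
    using xs ys by (auto simp: ham_ring_def)
  have verts: "{P, Q} \<subseteq> token_sets m k" "insert m ` {P, Q} \<subseteq> token_sets m (Suc k)"
    using ring_edges_subset[OF ne(2) e(1)] ring_edges_subset[OF ne(1) e(2)] unfolding set by this+
  have slide: "{insert m A, ?ins A} \<in> fan_moves" if "A \<in> {P, Q}" for A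
  proof (rule fan_movesI)
    have A: "A \<in> token_sets m k" "insert m A \<in> token_sets m (Suc k)" using verts that by auto
    \<comment> \<open>Otherwise inserting \<open>m\<close> would not increase the number of tokens.\<close>
    then have "m \<notin> A" by (auto simp: token_sets_def insert_absorb)
    moreover have "Suc m \<notin> A" using A by (auto simp: token_sets_def)
    ultimately show "sym_diff (insert m A) (?ins A) = {m, Suc m}" by auto
  qed (simp add: fan_adj_def)
  have edges: "ring_edges (map ?ins ys) = image ?ins ` ring_edges ys" by (rule ring_edges_map[OF ne(2)])
  have disj: "token_sets m (Suc k) \<inter> ?ins ` token_sets m k = {}" by (auto simp: token_sets_def)
  have "?ins ` {P, Q} \<in> ring_edges (map ?ins ys)" unfolding edges using e(1) by (rule imageI)
  then have "{?ins P, ?ins Q} \<in> ring_edges (map ?ins ys)" by simp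
  moreover have "{insert m P, insert m Q} \<in> ring_edges xs" using e by simp
  ultimately obtain zs where zs: "ham_ring (token_sets (Suc m) (Suc k)) fan_moves zs"
    "ring_edges xs - {insert m ` {P, Q}} \<union> (ring_edges (map ?ins ys) - {?ins ` {P, Q}}) \<subseteq> ring_edges zs"
    using ham_ring_merge[OF xs ham_ring_insert[OF ys] disj, of "insert m P" "insert m Q" "?ins P" "?ins Q"]
      slide[of P] slide[of Q]
    unfolding token_sets_Suc image_insert image_empty by blast
  \<comment> \<open>The removed edges differ from all edges that have to be kept.\<close>
  have "m \<notin> {0..<Suc k}" using assms(2) by simp
  then have "{0..<Suc k} \<notin> insert m ` {P, Q}" by blast
  moreover have "{0..<Suc k} \<in> exchange_edge1 (Suc k)" "{0..<Suc k} \<in> exchange_edge2 (Suc k)"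
    using assms(1) by (auto simp: exchange_edge1_def exchange_edge2_def)
  ultimately have "exchange_edge1 (Suc k) \<noteq> insert m ` {P, Q}" "exchange_edge2 (Suc k) \<noteq> insert m ` {P, Q}"
    by metis+
  moreover have "?ins ` e' \<noteq> ?ins ` {P, Q}"
  proof -
    have "token_sets m k \<subseteq> {A. Suc m \<notin> A}" by (auto simp: token_sets_def)
    then have "{P, Q} \<subseteq> {A. Suc m \<notin> A}" "e' \<subseteq> {A. Suc m \<notin> A}"
      using ring_edges_subset[OF ne(2)] e(1) e'(1) set(2) by (metis subset_trans)+
    then show ?thesis
      using e'(2) inj_on_image_eq_iff[OF insert_inj_on, of e' "Suc m" "{P, Q}"] by metis
  qed
  moreover have "?ins ` e' \<in> ring_edges (map ?ins ys)" unfolding edges using e'(1) by (rule imageI)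
  moreover have "f \<in> ring_edges zs"
    if "f \<in> ring_edges xs \<and> f \<noteq> insert m ` {P, Q}
      \<or> f \<in> ring_edges (map ?ins ys) \<and> f \<noteq> ?ins ` {P, Q}" for f
    by (rule subsetD[OF zs(2)]) (use that in simp)
  ultimately show ?thesis
    using zs(1) keep by metis
qed

text \<open>
  The induction on \<open>m\<close> for fixed \<open>k\<close> carries the additional invariant that one of the two exchange
  edges of the level below, lifted by the last vertex \<open>m\<close>, is on the cycle. A fusion
  uses up this one and leaves the other, so that the two take turns.
\<close>

lemma fan_token_ring:
  assumes "1 \<le> k" "k \<le> m" "2 \<le> m"
  shows "\<exists>xs. ham_ring (token_sets m k) fan_moves xs
    \<and> exchange_edge1 k \<in> ring_edges xs \<and> exchange_edge2 k \<in> ring_edges xs"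
  using assms
proof (induction k arbitrary: m rule: dec_induct)
  case base
  then show ?case using one_token_ring by simp
next
  case (step k)
  have "\<exists>xs. ham_ring (token_sets m (Suc k)) fan_moves xs
      \<and> exchange_edge1 (Suc k) \<in> ring_edges xs \<and> exchange_edge2 (Suc k) \<in> ring_edges xs
      \<and> (\<exists>e \<in> {exchange_edge1 k, exchange_edge2 k}. insert m ` e \<in> ring_edges xs)"
    using step.prems(1)
  proof (induction m rule: dec_induct)
    case base
    then show ?case using one_gap_ring[of "Suc k"] step.hyps by auto
  next
    case (step m')
    have k: "1 \<le> k" "Suc k \<le> m'" using \<open>1 \<le> k\<close> step.hyps by auto
    obtain xs e where xs: "ham_ring (token_sets m' (Suc k)) fan_moves xs"
      "exchange_edge1 (Suc k) \<in> ring_edges xs" "exchange_edge2 (Suc k) \<in> ring_edges xs"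
      "e \<in> {exchange_edge1 k, exchange_edge2 k}" "insert m' ` e \<in> ring_edges xs"
      using step.IH by blast
    obtain ys where ys: "ham_ring (token_sets m' k) fan_moves ys"
      "exchange_edge1 k \<in> ring_edges ys" "exchange_edge2 k \<in> ring_edges ys"
      using \<open>\<And>m. k \<le> m \<Longrightarrow> 2 \<le> m \<Longrightarrow> _ m\<close>[of m'] k by auto
    obtain P Q where e: "e = {P, Q}"
      using xs(4) that by (cases "k = 1") (auto simp: exchange_edge1_def exchange_edge2_def)
    obtain e' where e': "e' \<in> {exchange_edge1 k, exchange_edge2 k}" "e' \<noteq> e"
      using exchange_edges_distinct[OF k(1)] by auto
    have "e \<in> ring_edges ys" "e' \<in> ring_edges ys" using ys(2,3) xs(4) e'(1) by auto
    then have "\<exists>zs. ham_ring (token_sets (Suc m') (Suc k)) fan_moves zs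
        \<and> exchange_edge1 (Suc k) \<in> ring_edges zs \<and> exchange_edge2 (Suc k) \<in> ring_edges zs
        \<and> insert (Suc m') ` e' \<in> ring_edges zs"
      using xs(5) e'(2) unfolding e by (intro exchange_step[OF k xs(1-3) ys(1)])
    then show ?case using e'(1) by blast
  qed
  then show ?case by blast
qed

section \<open>From cyclic lists to Hamiltonian token graphs\<close>

lemma cas_zip: "pcas x (zip (x # ys) (ys @ [z])) z"
  by (induction ys arbitrary: x) auto

lemma awalk_verts_zip: "pawalk_verts x (zip (x # ys) (ys @ [z])) = x # ys @ [z]"
  by (induction ys arbitrary: x) auto

lemma path_edges_zip:
  "path_edges (x # ys @ [z]) = (\<lambda>(a, b). {a, b}) ` set (zip (x # ys) (ys @ [z]))"
  by (induction ys arbitrary: x) auto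

lemma hamiltonian_if_ham_ring:
  fixes T :: "'a pair_pre_digraph"
  assumes "sym (parcs T)"
    and ring: "ham_ring (pverts T) {{A, B} | A B. (A, B) \<in> parcs T} xs"
  shows "hamiltonian T"
proof -
  have len: "3 \<le> length xs" using ring by (simp add: ham_ring_def)
  then obtain x ys where xs: "xs = x # ys" by (cases xs) auto
  let ?p = "zip (x # ys) (ys @ [x])"
  have "path_edges (x # ys @ [x]) = ring_edges xs"
    using path_edges_append[of "x # ys" "[x]"] by (simp add: ring_edges_def xs)
  then have edges: "(\<lambda>(a, b). {a, b}) ` set ?p \<subseteq> {{A, B} | A B. (A, B) \<in> parcs T}"
    using ring unfolding path_edges_zip ham_ring_def by (simp only:)
  have arcs: "set ?p \<subseteq> parcs T"
  proof (rule subrelI)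
    fix a b assume "(a, b) \<in> set ?p"
    then have "{a, b} \<in> {{A, B} | A B. (A, B) \<in> parcs T}"
      by (intro subsetD[OF edges]) (rule image_eqI[of _ _ "(a, b)"], simp)
    then obtain A B where "{a, b} = {A, B}" "(A, B) \<in> parcs T" by blast
    then show "(a, b) \<in> parcs T" using symD[OF assms(1)] by (metis doubleton_eq_iff)
  qed
  have set: "set (x # ys) = pverts T" and dist: "distinct (x # ys)"
    using ring unfolding ham_ring_def xs by (simp_all only:)
  have tr: "pre_digraph.awalk_verts (with_proj T) x ?p = x # ys @ [x]"
    unfolding awalk_verts_with_proj_eq by (rule awalk_verts_zip)
  have "x \<in> pverts T" unfolding set[symmetric] by simp
  then have walk: "pre_digraph.awalk (with_proj T) x ?p x"
    unfolding pre_digraph.awalk_def cas_with_proj_eq with_proj_simps using arcs cas_zip[of x ys x] by blast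
  have "distinct (tl (x # ys @ [x]))" using dist by simp
  moreover have "length ?p = length xs" by (simp add: xs)
  moreover from this have "?p \<noteq> []" using len by (metis list.size(3) not_numeral_le_zero)
  ultimately have "pre_digraph.cycle (with_proj T) ?p"
    unfolding pre_digraph.cycle_def using walk tr by metis
  moreover have "set (x # ys @ [x]) = pverts T" unfolding set[symmetric] by auto
  ultimately have "hamiltonian_cycle (with_proj T) x ?p"
    unfolding hamiltonian_cycle_def tr with_proj_simps using walk len \<open>length ?p = length xs\<close> by metis
  then show ?thesis unfolding hamiltonian_def by blast
qed

text \<open>
  A labelling of the vertices that maps fan edges to edges of \<open>G\<close> maps token moves on the
  fan to token moves on \<open>G\<close>, because an injective map commutes with symmetric differences.
\<close>

lemma hamiltonian_token_graph_if_fan: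
  fixes G :: "'a pair_pre_digraph"
  assumes G: "pair_graph G" and bij: "bij_betw g {0..m} (pverts G)"
    and adj: "\<And>a b. fan_adj a b \<Longrightarrow> a \<le> m \<Longrightarrow> b \<le> m \<Longrightarrow> (g a, g b) \<in> parcs G"
    and "1 \<le> k" "k \<le> m" "2 \<le> m"
  shows "hamiltonian (token_graph G k)"
proof -
  interpret T: pair_graph "token_graph G k" using G by (rule token_graph_pair_graph)
  have sym: "sym (parcs (token_graph G k))" by (rule T.arcs_symmetric[THEN symI])
  obtain xs where xs: "ham_ring (token_sets m k) fan_moves xs"
    using fan_token_ring assms by blast
  then have ne: "xs \<noteq> []" and set: "set xs = token_sets m k" by (auto simp: ham_ring_def)
  have inj: "inj_on g {0..m}" and im: "g ` {0..m} = pverts G" using bij by (auto simp: bij_betw_def)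
  have sub: "token_sets m k \<subseteq> Pow {0..m}" by (auto simp: token_sets_def)
  have inj2: "inj_on (image g) (token_sets m k)"
    using inj_on_image_Pow[OF inj] sub by (rule inj_on_subset)
  have card: "card (g ` A) = card A" if "A \<subseteq> {0..m}" for A
    using inj that by (meson card_image inj_on_subset)
  have verts: "image g ` token_sets m k = pverts (token_graph G k)"
  proof -
    have "B \<in> image g ` token_sets m k" if "B \<subseteq> pverts G" "card B = k" for B
    proof -
      obtain A where "A \<subseteq> {0..m}" "B = g ` A" using \<open>B \<subseteq> pverts G\<close> im by (metis subset_image_iff)
      then show ?thesis using card that by (auto simp: token_sets_def)
    qed
    moreover have "g ` A \<subseteq> pverts G \<and> card (g ` A) = k" if "A \<in> token_sets m k" for A
      using that card im by (auto simp: token_sets_def)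
    ultimately have "image g ` token_sets m k = {B. B \<subseteq> pverts G \<and> card B = k}"
      by (intro equalityI subsetI) (simp_all only: mem_Collect_eq image_iff, metis+)
    then show ?thesis by (simp add: token_graph_def)
  qed
  have "image g ` e \<in> {{A, B} | A B. (A, B) \<in> parcs (token_graph G k)}" if e: "e \<in> ring_edges xs" for e
  proof -
    obtain A B a b where AB: "e = {A, B}" "fan_adj a b" "sym_diff A B = {a, b}"
      using e xs unfolding ham_ring_def fan_moves_def by blast
    have in_sets: "A \<in> token_sets m k" "B \<in> token_sets m k"
      using ring_edges_subset[OF ne e] set AB by auto
    then have AB_sub: "A \<subseteq> {0..m}" "B \<subseteq> {0..m}" by (auto simp: token_sets_def)
    then have "{a, b} \<subseteq> {0..m}" unfolding AB(3)[symmetric] by blast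
    then have "a \<le> m" "b \<le> m" by simp_all
    then have "(g a, g b) \<in> parcs G" using adj AB by blast
    moreover have "sym_diff (g ` A) (g ` B) = g ` sym_diff A B"
    proof -
      have "g ` (A - B) = g ` A - g ` B" "g ` (B - A) = g ` B - g ` A"
        using AB_sub by (auto intro!: inj_on_image_set_diff[OF inj])
      then show ?thesis by (simp only: image_Un)
    qed
    ultimately have "\<exists>a b. (a, b) \<in> parcs G \<and> sym_diff (g ` A) (g ` B) = {a, b}"
      unfolding AB(3) by auto
    moreover have "g ` A \<in> pverts (token_graph G k)" "g ` B \<in> pverts (token_graph G k)"
      using in_sets verts by auto
    ultimately have "(g ` A, g ` B) \<in> parcs (token_graph G k)"
      unfolding token_graph_def pair_pre_digraph.simps mem_Collect_eq prod.case by blast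
    then show ?thesis unfolding AB(1) by auto
  qed
  then have "ring_edges (map (image g) xs) \<subseteq> {{A, B} | A B. (A, B) \<in> parcs (token_graph G k)}"
    unfolding ring_edges_map[OF ne] by blast
  then have "ham_ring (pverts (token_graph G k)) {{A, B} | A B. (A, B) \<in> parcs (token_graph G k)}
      (map (image g) xs)"
    using xs inj2 verts set unfolding ham_ring_def by (simp add: distinct_map)
  with sym show ?thesis by (rule hamiltonian_if_ham_ring)
qed

section \<open>Spanning fans\<close>

definition fan_label :: "nat \<Rightarrow> nat + nat" where
  "fan_label i = (if i = 0 then Inl 0 else Inr (i - 1))"

lemma bij_betw_fan_label:
  "1 \<le> n \<Longrightarrow> bij_betw fan_label {0..n - 1} ({0..<1} <+> {0..<n - 1})"
  by (rule bij_betw_byWitness[where f' = "case_sum (\<lambda>_. 0) Suc"]) (auto simp: fan_label_def)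

lemma fan_label_arc:
  "fan_adj a b \<Longrightarrow> a \<le> n - 1 \<Longrightarrow> b \<le> n - 1 \<Longrightarrow> (fan_label a, fan_label b) \<in> parcs (fan_graph n)"
  by (auto simp: fan_graph_def graph_join_def complete_graph_def path_graph_def fan_label_def fan_adj_def)

lemma fan_graph_arc_wheel: "parcs (fan_graph n) \<subseteq> parcs (wheel_graph n)"
  by (auto simp: fan_graph_def wheel_graph_def graph_join_def path_graph_def cycle_graph_def)

text \<open>
  The isomorphism provided by the definition leads from the spanning subgraph to the fan; the labelling is its
  inverse on vertices.
\<close>

lemma spanning_fan_labelling:
  fixes G :: "'a pair_pre_digraph"
  assumes "has_spanning_subgraph_iso G (fan_graph n)"
  shows "\<exists>h. bij_betw h (pverts (fan_graph n)) (pverts G)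
    \<and> (\<forall>(x, y) \<in> parcs (fan_graph n). (h x, h y) \<in> parcs G)"
proof -
  obtain H f where H: "pair_graph H" "spanning (with_proj H) (with_proj G)"
    and f: "pre_digraph.digraph_isomorphism (with_proj H) f" "with_proj (fan_graph n) = app_iso f (with_proj H)"
    using assms unfolding has_spanning_subgraph_iso_def digraph_iso_def by blast
  interpret H: pair_graph H by fact
  have pv: "pverts H = pverts G" and pa: "parcs H \<subseteq> parcs G"
    using H(2) by (auto simp: spanning_def subgraph_def)
  have vf: "pverts (fan_graph n) = iso_verts f ` pverts H"
    and af: "parcs (fan_graph n) = iso_arcs f ` parcs H" and tl: "iso_tail f = fst" and hd: "iso_head f = snd"
    using arg_cong[OF f(2), of verts] arg_cong[OF f(2), of arcs] arg_cong[OF f(2), of tail]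
      arg_cong[OF f(2), of head] by simp_all
  have inj: "inj_on (iso_verts f) (pverts H)"
    using f(1) by (simp add: pre_digraph.digraph_isomorphism_def)
  let ?h = "the_inv_into (pverts H) (iso_verts f)"
  have "bij_betw ?h (pverts (fan_graph n)) (pverts G)"
    using inj unfolding vf pv[symmetric] by (intro bij_betw_the_inv_into) (simp add: bij_betw_def)
  moreover have "(?h x, ?h y) \<in> parcs G" if "(x, y) \<in> parcs (fan_graph n)" for x y
  proof -
    obtain e where "e \<in> parcs H" "(x, y) = iso_arcs f e"
      using \<open>(x, y) \<in> _\<close>[unfolded af] by (rule imageE)
    then obtain u v where uv: "(u, v) \<in> parcs H" "iso_arcs f (u, v) = (x, y)"
      by (cases e) simp
    then have "iso_verts f u = x" "iso_verts f v = y"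
      using f(1) tl hd unfolding pre_digraph.digraph_isomorphism_def by force+
    moreover have "u \<in> pverts H" "v \<in> pverts H" using H.wellformed'[OF uv(1)] by auto
    ultimately have "?h x = u" "?h y = v" using inj by (auto simp: the_inv_into_f_f)
    then show ?thesis using uv(1) pa by auto
  qed
  ultimately show ?thesis by blast
qed

theorem corollary2p5:
  fixes n k :: nat
  assumes "3 \<le> n" and "1 \<le> k" and "k \<le> n - 1"
  shows "(\<forall>G :: 'a pair_pre_digraph.
            pair_graph G \<longrightarrow> card (pverts G) = n \<longrightarrow> has_spanning_subgraph_iso G (fan_graph n)
              \<longrightarrow> hamiltonian (token_graph G k))
       \<and> hamiltonian (johnson_graph n k)
       \<and> (4 \<le> n \<longrightarrow> hamiltonian (token_graph (wheel_graph n) k))"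
proof (intro conjI allI impI)
  have n: "2 \<le> n - 1" "1 \<le> n" using assms by auto
  have fan_verts: "pverts (fan_graph n) = {0..<1} <+> {0..<n - 1}"
    and wheel_verts: "pverts (wheel_graph n) = {0..<1} <+> {0..<n - 1}"
    by (auto simp: fan_graph_def wheel_graph_def graph_join_def complete_graph_def path_graph_def cycle_graph_def)
  note label = bij_betw_fan_label[OF n(2)]
  show "hamiltonian (token_graph G k)"
    if G: "pair_graph G" and span: "has_spanning_subgraph_iso G (fan_graph n)" for G :: "'a pair_pre_digraph"
  proof -
    obtain h where h: "bij_betw h (pverts (fan_graph n)) (pverts G)"
      "\<And>x y. (x, y) \<in> parcs (fan_graph n) \<Longrightarrow> (h x, h y) \<in> parcs G"
      using spanning_fan_labelling[OF span] by blast
    have "bij_betw (h \<circ> fan_label) {0..n - 1} (pverts G)"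
      using label h(1) unfolding fan_verts by (rule bij_betw_trans)
    then show ?thesis
      using G assms n h(2)[OF fan_label_arc]
      by (intro hamiltonian_token_graph_if_fan[of G "h \<circ> fan_label" "n - 1"]) auto
  qed
  have "bij_betw id {0..n - 1} (pverts (complete_graph n))"
    using n by (auto simp: bij_betw_def complete_graph_def)
  then show "hamiltonian (johnson_graph n k)"
    unfolding johnson_graph_eq_token_graph using assms n
    by (intro hamiltonian_token_graph_if_fan[of _ id "n - 1"] complete_graph_pair_graph)
      (auto simp: complete_graph_def fan_adj_def)
  have "pair_graph (wheel_graph n)"
    unfolding wheel_graph_def
    by (intro graph_join_pair_graph complete_graph_pair_graph cycle_graph_pair_graph)
  then show "hamiltonian (token_graph (wheel_graph n) k)"
    using label[folded wheel_verts] assms n subsetD[OF fan_graph_arc_wheel fan_label_arc]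
    by (intro hamiltonian_token_graph_if_fan[of _ fan_label "n - 1"]) auto
qed

end
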